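(* Let $K$ be a finite field of characteristic $p$, let $A_1,\ldots,A_s$ be subgroups of the multiplicative group $K^*$, let $B_i=A_i\cup\{0\}$, let $\mathcal{X}=B_1\times\cdots\times B_s\subset K^s$, and let $I\subset S=K[t_1,\ldots,t_s]$ be the vanishing ideal of $\mathcal{X}$. Let $\prec$ be a graded monomial order on $S$. Put $d_i=|A_i|$ and $e_i=|B_i|=d_i+1$, and assume that $\gcd(e_i,p)=p$ for $i=1,\ldots,s$. Let $d$ be an integer with $-1\leq d\leq r_0:=\sum_{i=1}^s(e_i-1)$, let $S_{\leq d}\cap\Delta_\prec(I)=\{t^{a_1},\ldots,t^{a_k}\}$ with $t^{a_i}=t_1^{a_{i,1}}\cdots t_s^{a_{i,s}}$, and let $\mathcal{L}=K(S_{\leq d}\cap\Delta_\prec(I))$. Then $$\mathcal{L}^\perp=K(\Delta_\prec(I)\setminus\{t^{b_1},\ldots,t^{b_k}\})=K(S_{\leq r_0-d-1}\cap\Delta_\prec(I)),$$ where $t^{b_i}=\prod_{j=1}^s t_j^{d_j-a_{i,j}}$ for $i=1,\ldots,k$.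
   Context: Write $\mathcal{X}=\{P_1,\ldots,P_m\}$. The vanishing ideal $I$ is the ideal of polynomials vanishing on $\mathcal{X}$. A graded monomial order compares monomials first by total degree. $\Delta_\prec(I)$ is the set of standard monomials of $S/I$ (monomials not in $\mathrm{in}_\prec(I)$); here it consists of all $t_1^{c_1}\cdots t_s^{c_s}$ with $0\le c_i\le d_i$ for all $i$. $K\mathcal{M}$ denotes the $K$-span in $S$ of a set $\mathcal{M}$. $S_{\le d}$ is the space of polynomials of total degree at most $d$, and $S_{\le -1}=\{0\}$. The algebraic dual of a finite-dimensional linear subspace $\mathcal{L}\subset S$ is $\mathcal{L}^\perp=\{g\in K\Delta_\prec(I): \varphi(gf)=0\text{ for all }f\in\mathcal{L}\}$, where $\varphi\colon S\to K$ is $\varphi(f)=f(P_1)+\cdots+f(P_m)$. *)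

theory Defs
  imports
    "HOL-Library.Poly_Mapping"
    "HOL-Algebra.Group"
    "HOL-Computational_Algebra.Computational_Algebra"
begin

text \<open>
  The polynomial ring \<open>S = K[t\<^sub>1, \<dots>, t\<^sub>s]\<close> is the library's ring of finitely supported functions
  from exponent vectors to coefficients. The variables are indexed by a type \<open>'n\<close>, which is
  finite wherever it matters, so that \<open>s = CARD('n)\<close>.
\<close>

type_synonym 'n expo = "'n \<Rightarrow>\<^sub>0 nat"
type_synonym ('n, 'k) mpol = "('n \<Rightarrow>\<^sub>0 nat) \<Rightarrow>\<^sub>0 'k"

abbreviation expo_at :: "'n expo \<Rightarrow> 'n \<Rightarrow> nat" where
  "expo_at \<equiv> Poly_Mapping.lookup"

definition tmon :: "'n expo \<Rightarrow> ('n, 'k::comm_ring_1) mpol" where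
  "tmon a = Poly_Mapping.single a 1"

definition tvar :: "'n \<Rightarrow> ('n, 'k::comm_ring_1) mpol" where
  "tvar j = tmon (Poly_Mapping.single j 1)"

definition tdeg :: "'n::finite expo \<Rightarrow> nat" where
  "tdeg a = (\<Sum>j\<in>UNIV. expo_at a j)"

definition peval :: "('n::finite, 'k::comm_ring_1) mpol \<Rightarrow> ('n \<Rightarrow> 'k) \<Rightarrow> 'k" where
  "peval f P = (\<Sum>a\<in>Poly_Mapping.keys f. Poly_Mapping.lookup f a * (\<Prod>j\<in>UNIV. P j ^ expo_at a j))"

definition pscale :: "'k::comm_ring_1 \<Rightarrow> ('n, 'k) mpol \<Rightarrow> ('n, 'k) mpol" where
  "pscale c f = Poly_Mapping.single 0 c * f"

lemma vector_space_pscale: "vector_space (pscale :: 'k::field \<Rightarrow> ('n, 'k) mpol \<Rightarrow> _)"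
  by unfold_locales
    (simp_all add: pscale_def algebra_simps single_add mult_single flip: mult.assoc)

lemma module_times: "module ((*) :: 'r::comm_ring_1 \<Rightarrow> 'r \<Rightarrow> 'r)"
  by unfold_locales (simp_all add: algebra_simps)

definition Kspan :: "('n, 'k::field) mpol set \<Rightarrow> ('n, 'k) mpol set" where
  "Kspan = module.span pscale"

definition ideal_generated :: "('n, 'k::field) mpol set \<Rightarrow> ('n, 'k) mpol set" where
  "ideal_generated = module.span (*)"

text \<open>Integer bound, so that \<open>polys_le (-1) = {0}\<close>.\<close>

definition polys_le :: "int \<Rightarrow> ('n::finite, 'k::comm_ring_1) mpol set" where
  "polys_le d = {f. \<forall>a\<in>Poly_Mapping.keys f. int (tdeg a) \<le> d}"

text \<open>Monomial orders are given by the strict order \<open>\<prec>\<close> on exponent vectors.\<close>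

definition monomial_order :: "('n expo \<Rightarrow> 'n expo \<Rightarrow> bool) \<Rightarrow> bool" where
  "monomial_order prec \<longleftrightarrow>
     irreflp prec \<and> transp prec \<and> totalp prec \<and>
     (\<forall>a. a \<noteq> 0 \<longrightarrow> prec 0 a) \<and>
     (\<forall>a b c. prec a b \<longrightarrow> prec (a + c) (b + c))"

definition graded_monomial_order :: "('n::finite expo \<Rightarrow> 'n expo \<Rightarrow> bool) \<Rightarrow> bool" where
  "graded_monomial_order prec \<longleftrightarrow>
     monomial_order prec \<and> (\<forall>a b. tdeg a < tdeg b \<longrightarrow> prec a b)"

definition lead_expo :: "('n expo \<Rightarrow> 'n expo \<Rightarrow> bool) \<Rightarrow> ('n, 'k::zero) mpol \<Rightarrow> 'n expo" where
  "lead_expo prec f =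
     (THE a. a \<in> Poly_Mapping.keys f \<and> (\<forall>b\<in>Poly_Mapping.keys f. b \<noteq> a \<longrightarrow> prec b a))"

definition initial_ideal ::
  "('n expo \<Rightarrow> 'n expo \<Rightarrow> bool) \<Rightarrow> ('n, 'k::field) mpol set \<Rightarrow> ('n, 'k) mpol set" where
  "initial_ideal prec I = ideal_generated {tmon (lead_expo prec f) | f. f \<in> I \<and> f \<noteq> 0}"

definition standard_monomials ::
  "('n expo \<Rightarrow> 'n expo \<Rightarrow> bool) \<Rightarrow> ('n, 'k::field) mpol set \<Rightarrow> ('n, 'k) mpol set" where
  "standard_monomials prec I = {tmon a | a. tmon a \<notin> initial_ideal prec I}"

definition vanishing_ideal :: "('n::finite \<Rightarrow> 'k::field) set \<Rightarrow> ('n, 'k) mpol set" where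
  "vanishing_ideal X = {f. \<forall>P\<in>X. peval f P = 0}"

definition eval_sum :: "('n::finite \<Rightarrow> 'k::field) set \<Rightarrow> ('n, 'k) mpol \<Rightarrow> 'k" where
  "eval_sum X f = (\<Sum>P\<in>X. peval f P)"

definition algebraic_dual ::
  "('n::finite expo \<Rightarrow> 'n expo \<Rightarrow> bool) \<Rightarrow> ('n \<Rightarrow> 'k::field) set \<Rightarrow> ('n, 'k) mpol set \<Rightarrow> ('n, 'k) mpol set" where
  "algebraic_dual prec X L =
     {g \<in> Kspan (standard_monomials prec (vanishing_ideal X)). \<forall>f\<in>L. eval_sum X (g * f) = 0}"

definition units_group :: "'k::field monoid" where
  "units_group = \<lparr>carrier = UNIV - {0}, monoid.mult = (*), one = 1\<rparr>"

end

theory Submission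
  imports Defs
begin

text \<open>
  The evaluation sum of a monomial over a grid factors into power sums over the factors
  \<open>B\<^sub>i = A\<^sub>i \<union> {0}\<close>. Because \<open>p\<close> divides \<open>|B\<^sub>i| = d\<^sub>i + 1\<close>, the power sum of exponent
  \<open>n\<close> vanishes for every \<open>n < d\<^sub>i\<close>, including \<open>n = 0\<close>, and equals \<open>d\<^sub>i = -1\<close> for \<open>n = d\<^sub>i\<close>
  (\<open>power_sum_insert_0\<close>). So, with \<open>D = (d\<^sub>1, \<dots>, d\<^sub>s)\<close>, a monomial \<open>t\<^sup>c\<close> has evaluation sum zero
  unless \<open>c \<ge> D\<close> in every variable, and \<open>t\<^sup>D\<close> has a nonzero evaluation sum.

  Everything follows from one consequence (\<open>eval_sum_complement_top_term\<close>): if \<open>t\<^sup>l\<close> is a term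
  of maximal degree of \<open>f\<close> and \<open>l \<le> D\<close>, then \<open>f t\<^bsup>D - l\<^esup>\<close> has a nonzero evaluation sum. Applied to
  a polynomial vanishing on the grid, it shows that the leading exponent for a graded order is never
  \<open>\<le> D\<close>; together with the vanishing polynomials \<open>t\<^sub>i\<^bsup>d\<^sub>i + 1\<^esup> - t\<^sub>i\<close> this determines the standard
  monomials (\<open>standard_monomials_grid\<close>) without any division algorithm. Applied to an element \<open>g\<close> of the
  algebraic dual, it shows that a term of top degree \<open>t\<^sup>l\<close> of \<open>g\<close> must have its complement \<open>t\<^bsup>D - l\<^esup>\<close>
  outside \<open>\<L>\<close>, which bounds the degree of \<open>g\<close> by \<open>r\<^sub>0 - d - 1\<close>. The reverse inclusion is a
  degree count: a product of total degree below \<open>r\<^sub>0\<close> has no term \<open>\<ge> D\<close>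
  (\<open>algebraic_dual_grid\<close>). Finally, the involution \<open>c \<mapsto> D - c\<close> of the standard exponents turns the
  condition \<open>degree \<le> d\<close> into \<open>degree \<ge> r\<^sub>0 - d\<close>, so removing the complements of the monomials of
  \<open>\<L>\<close> leaves exactly those of degree at most \<open>r\<^sub>0 - d - 1\<close> (\<open>box_minus_complements\<close>).
\<close>

section \<open>Power sums over a multiplicative group with zero adjoined\<close>

text \<open>Multiplication by \<open>x\<close> permutes \<open>A\<close>, so it leaves the product of all elements unchanged.\<close>

lemma power_eq_one_of_finite_mult_closed:
  fixes A :: "'k::field set"
  assumes "finite A" "0 \<notin> A" "\<And>x y. x \<in> A \<Longrightarrow> y \<in> A \<Longrightarrow> x * y \<in> A" "x \<in> A"
  shows "x ^ card A = 1"
proof -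
  have inj: "inj_on ((*) x) A"
    using assms by (auto simp: inj_on_def)
  moreover have "(*) x ` A = A"
    using assms inj by (intro card_subset_eq) (auto simp: card_image)
  ultimately have "(\<Prod>y\<in>A. x * y) = \<Prod>A"
    using prod.reindex[OF inj, of "\<lambda>y. y"] by simp
  then have "x ^ card A * \<Prod>A = 1 * \<Prod>A"
    by (simp add: prod.distrib)
  moreover have "\<Prod>A \<noteq> 0"
    using assms by (simp add: prod_zero_iff)
  ultimately show ?thesis
    by (simp only: mult_cancel_right) simp
qed

lemma card_le_of_power_eq_one:
  fixes A :: "'k::field set"
  assumes "n > 0" "\<And>x. x \<in> A \<Longrightarrow> x ^ n = 1"
  shows "card A \<le> n"
proof -
  define q :: "'k poly" where "q = monom 1 n - 1"
  have deg: "degree q \<le> n"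
    unfolding q_def by (intro degree_diff_le) (auto simp: degree_monom_le)
  have "coeff q n = 1"
    using assms(1) by (simp add: q_def)
  then have "q \<noteq> 0" by auto
  then have "finite {x. poly q x = 0}" "card {x. poly q x = 0} \<le> degree q"
    by (rule poly_roots_finite, rule card_poly_roots_bound)
  moreover have "A \<subseteq> {x. poly q x = 0}"
    using assms(2) by (auto simp: q_def poly_monom)
  ultimately show ?thesis
    using deg card_mono[of "{x. poly q x = 0}" A] by linarith
qed

text \<open>The polynomial \<open>x\<^sup>n - 1\<close> has too few roots to kill all of \<open>A\<close>, so some \<open>y \<in> A\<close> has
  \<open>y\<^sup>n \<noteq> 1\<close>. Multiplication by \<open>y\<close> permutes \<open>A\<close> and scales the power sum by \<open>y\<^sup>n\<close>.\<close>

lemma power_sum_eq_0: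
  fixes A :: "'k::field set"
  assumes "finite A" "0 \<notin> A" "\<And>x y. x \<in> A \<Longrightarrow> y \<in> A \<Longrightarrow> x * y \<in> A"
    and "0 < n" "n < card A"
  shows "(\<Sum>x\<in>A. x ^ n) = 0"
proof -
  obtain y where y: "y \<in> A" "y ^ n \<noteq> 1"
    using card_le_of_power_eq_one[of n A] assms(4,5) by force
  have inj: "inj_on ((*) y) A"
    using assms y by (auto simp: inj_on_def)
  moreover have "(*) y ` A = A"
    using assms y inj by (intro card_subset_eq) (auto simp: card_image)
  ultimately have "(\<Sum>x\<in>A. (y * x) ^ n) = (\<Sum>x\<in>A. x ^ n)"
    using sum.reindex[OF inj, of "\<lambda>x. x ^ n"] by simp
  then have "y ^ n * (\<Sum>x\<in>A. x ^ n) = (\<Sum>x\<in>A. x ^ n)"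
    by (simp add: power_mult_distrib sum_distrib_left)
  then show ?thesis
    using y by (metis mult_cancel_right1 mult.commute)
qed

text \<open>The adjoined zero matters only for \<open>n = 0\<close>, where \<open>0\<^sup>0 = 1\<close> raises the sum from \<open>|A|\<close> to
  \<open>|A| + 1\<close>; this is where the divisibility of \<open>|A| + 1\<close> by the characteristic enters a second time,
  besides giving \<open>|A| = -1\<close> for the top exponent.\<close>

lemma power_sum_insert_0:
  fixes A :: "'k::field set"
  assumes "finite A" "0 \<notin> A" "\<And>x y. x \<in> A \<Longrightarrow> y \<in> A \<Longrightarrow> x * y \<in> A"
    and "of_nat (card (insert 0 A)) = (0 :: 'k)"
    and "n \<le> card A" "A \<noteq> {}"
  shows "(\<Sum>x\<in>insert 0 A. x ^ n) = (if n = card A then - 1 else 0)"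
proof -
  have card: "of_nat (card A) = (- 1 :: 'k)"
    using assms(1,2,4) by (simp add: eq_neg_iff_add_eq_0 add.commute)
  have pos: "card A > 0"
    using assms by (simp add: card_gt_0_iff)
  consider "n = 0" | "0 < n" "n < card A" | "n = card A"
    using assms(5) by linarith
  then show ?thesis
  proof cases
    case 1
    then show ?thesis using card assms(1,2,6) by simp
  next
    case 2
    then show ?thesis using power_sum_eq_0[OF assms(1-3)] assms(1,2) by simp
  next
    case 3
    have "(\<Sum>x\<in>A. x ^ n) = (\<Sum>x\<in>A. 1)"
      using power_eq_one_of_finite_mult_closed[OF assms(1-3)] 3 by (intro sum.cong) auto
    then show ?thesis using 3 pos assms(1,2) card by simp
  qed
qed

section \<open>Evaluation, spans and ideals of monomials\<close>

lemma peval_add: "peval (f + g) P = peval f P + peval g P"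
  unfolding peval_def by (rule setsum_keys_plus_distrib) (simp_all add: algebra_simps)

lemma peval_single: "peval (Poly_Mapping.single a c) P = c * (\<Prod>j\<in>UNIV. P j ^ expo_at a j)"
  by (cases "c = 0") (simp_all add: peval_def)

lemma eval_sum_0: "eval_sum X 0 = 0"
  by (simp add: eval_sum_def peval_def)

lemma eval_sum_add: "eval_sum X (f + g) = eval_sum X f + eval_sum X g"
  by (simp add: eval_sum_def peval_add sum.distrib)

lemma eval_sum_sum: "eval_sum X (\<Sum>i\<in>S. f i) = (\<Sum>i\<in>S. eval_sum X (f i))"
  by (induction S rule: infinite_finite_induct) (simp_all add: eval_sum_0 eval_sum_add)

lemma sum_single_lookup:
  "(\<Sum>a\<in>Poly_Mapping.keys f. Poly_Mapping.single a (Poly_Mapping.lookup f a)) = f"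
  by (rule poly_mapping_eqI)
     (auto simp: lookup_sum lookup_single when_def sum.delta in_keys_iff)

lemma eval_sum_mult_tmon:
  "eval_sum X (f * tmon a) = (\<Sum>b\<in>Poly_Mapping.keys f. Poly_Mapping.lookup f b * eval_sum X (tmon (b + a)))"
proof -
  have "f * tmon a =
      (\<Sum>b\<in>Poly_Mapping.keys f. Poly_Mapping.single b (Poly_Mapping.lookup f b)) * tmon a"
    by (simp only: sum_single_lookup)
  also have "\<dots> = (\<Sum>b\<in>Poly_Mapping.keys f. Poly_Mapping.single (b + a) (Poly_Mapping.lookup f b))"
    by (simp add: tmon_def sum_distrib_right mult_single)
  finally show ?thesis
    by (simp add: eval_sum_sum) (simp add: eval_sum_def peval_single tmon_def sum_distrib_left)
qed

text \<open>The evaluation sum weights the value of \<open>f\<close> at each point by that of the monomial.\<close>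

lemma eval_sum_vanishing:
  assumes "f \<in> vanishing_ideal X"
  shows "eval_sum X (f * tmon a) = 0"
proof -
  have "eval_sum X (f * tmon a) = (\<Sum>P\<in>X. (\<Prod>j\<in>UNIV. P j ^ expo_at a j) * peval f P)"
    unfolding eval_sum_mult_tmon
    by (simp add: eval_sum_def peval_single tmon_def sum_distrib_left sum_distrib_right peval_def
        lookup_add power_add prod.distrib mult_ac sum.swap[of _ X])
  then show ?thesis
    using assms by (simp add: vanishing_ideal_def)
qed

lemma tmon_inject: "tmon a = (tmon b :: ('n, 'k::comm_ring_1) mpol) \<longleftrightarrow> a = b"
proof
  assume "tmon a = (tmon b :: ('n, 'k) mpol)"
  then have "Poly_Mapping.lookup (tmon a :: ('n, 'k) mpol) a = Poly_Mapping.lookup (tmon b) a"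
    by simp
  then show "a = b"
    by (auto simp: tmon_def lookup_single when_def split: if_splits)
qed simp

lemma keys_tmon: "Poly_Mapping.keys (tmon a :: ('n, 'k::comm_ring_1) mpol) = {a}"
  by (simp add: tmon_def)

lemma tmon_mult: "tmon a * tmon b = tmon (a + b)"
  by (simp add: tmon_def mult_single)

lemma tvar_power: "tvar j ^ n = tmon (Poly_Mapping.single j n)"
proof (induction n)
  case 0
  then show ?case by (simp add: tmon_def)
next
  case (Suc n)
  then show ?case by (simp add: tvar_def tmon_mult flip: single_add)
qed

lemma prod_tmon: "(\<Prod>j\<in>S. tmon (f j)) = tmon (\<Sum>j\<in>S. f j)"
  by (induction S rule: infinite_finite_induct) (simp_all add: tmon_mult, simp_all add: tmon_def)

lemma prod_tvar_power:
  fixes c :: "'n::finite expo"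
  shows "(\<Prod>j\<in>UNIV. tvar j ^ expo_at c j) = tmon c"
proof -
  have "(\<Sum>j\<in>UNIV. Poly_Mapping.single j (expo_at c j)) = c"
    by (rule poly_mapping_eqI) (simp add: lookup_sum lookup_single when_def)
  then show ?thesis by (simp add: tvar_power prod_tmon)
qed

lemma tdeg_add: "tdeg (a + b) = tdeg a + tdeg b"
  by (simp add: tdeg_def lookup_add sum.distrib)

text \<open>Subtraction of exponent vectors is truncated in each variable; the bound \<open>c \<le> D\<close> makes it
  an honest complement.\<close>

lemma complement_add:
  assumes "\<And>j. expo_at c j \<le> expo_at D j"
  shows "(D - c) + c = (D :: 'n expo)"
  using assms by (intro poly_mapping_eqI) (simp add: lookup_add lookup_minus)

lemma tdeg_complement:
  assumes "\<And>j. expo_at c j \<le> expo_at D j"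
  shows "tdeg (D - c) + tdeg c = tdeg D"
  using complement_add[OF assms] tdeg_add by metis

text \<open>Working with supports instead of linear combinations reduces membership in all the spans of
  monomials below to a condition on exponents.\<close>

lemma Kspan_tmon:
  fixes M :: "'n expo set"
  shows "Kspan (tmon ` M) = {f :: ('n, 'k::field) mpol. Poly_Mapping.keys f \<subseteq> M}"
proof -
  interpret vs: vector_space "pscale :: 'k \<Rightarrow> ('n, 'k) mpol \<Rightarrow> _"
    by (rule vector_space_pscale)
  have scale: "pscale c f = Poly_Mapping.single 0 c * f" for c and f :: "('n, 'k) mpol"
    by (simp add: pscale_def)
  have sub: "vs.subspace {f. Poly_Mapping.keys f \<subseteq> M}"
  proof (rule vs.subspaceI)
    fix c :: 'k and f :: "('n, 'k) mpol"
    assume "f \<in> {f. Poly_Mapping.keys f \<subseteq> M}"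
    then show "pscale c f \<in> {f. Poly_Mapping.keys f \<subseteq> M}"
      using keys_mult[of "Poly_Mapping.single 0 c" f] by (fastforce simp: scale split: if_splits)
  qed (use keys_add in \<open>fastforce+\<close>)
  show ?thesis
    unfolding Kspan_def
  proof (intro equalityI vs.span_minimal[OF _ sub] subsetI)
    fix f :: "('n, 'k) mpol"
    assume f: "f \<in> {f. Poly_Mapping.keys f \<subseteq> M}"
    have "(\<Sum>a\<in>Poly_Mapping.keys f. pscale (Poly_Mapping.lookup f a) (tmon a)) \<in> vs.span (tmon ` M)"
      using f by (intro vs.span_sum vs.span_scale vs.span_base) auto
    moreover have "pscale (Poly_Mapping.lookup f a) (tmon a) = Poly_Mapping.single a (Poly_Mapping.lookup f a)" for a
      by (simp add: pscale_def tmon_def mult_single)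
    ultimately show "f \<in> vs.span (tmon ` M)"
      by (simp add: sum_single_lookup)
  qed (auto simp: keys_tmon)
qed

text \<open>The polynomials all of whose exponents are of the form \<open>c + l\<close> with \<open>l \<in> M\<close> already form an
  ideal containing the generators, so a monomial in a monomial ideal is a multiple of a generator.\<close>

lemma tmon_in_monomial_ideal_iff:
  "(tmon a :: ('n, 'k::field) mpol) \<in> ideal_generated (tmon ` M) \<longleftrightarrow> (\<exists>l\<in>M. \<exists>c. a = c + l)"
proof
  interpret m: module "(*) :: ('n, 'k) mpol \<Rightarrow> _"
    by (rule module_times)
  let ?N = "{c + l | c l. l \<in> M}"
  have "m.subspace {f. Poly_Mapping.keys f \<subseteq> ?N}"
  proof (rule m.subspaceI)
    fix g f :: "('n, 'k) mpol"
    assume "f \<in> {f. Poly_Mapping.keys f \<subseteq> ?N}"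
    moreover have "b + (c + l) = (b + c) + l" for b c l :: "'n expo"
      by (simp add: add.assoc)
    ultimately show "g * f \<in> {f. Poly_Mapping.keys f \<subseteq> ?N}"
      using keys_mult[of g f] by blast
  qed (use keys_add in \<open>fastforce+\<close>)
  moreover have "tmon ` M \<subseteq> {f :: ('n, 'k) mpol. Poly_Mapping.keys f \<subseteq> ?N}"
    by (auto simp: keys_tmon) (metis add_0)
  ultimately have *: "ideal_generated (tmon ` M) \<subseteq> {f :: ('n, 'k) mpol. Poly_Mapping.keys f \<subseteq> ?N}"
    unfolding ideal_generated_def by (intro m.span_minimal)
  {
    assume "(tmon a :: ('n, 'k) mpol) \<in> ideal_generated (tmon ` M)"
    then have "Poly_Mapping.keys (tmon a :: ('n, 'k) mpol) \<subseteq> ?N"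
      using * by blast
    then show "\<exists>l\<in>M. \<exists>c. a = c + l"
      by (auto simp: keys_tmon)
  next
    assume "\<exists>l\<in>M. \<exists>c. a = c + l"
    then obtain l c where "l \<in> M" "a = c + l" by blast
    then show "(tmon a :: ('n, 'k) mpol) \<in> ideal_generated (tmon ` M)"
      unfolding ideal_generated_def
      by (simp flip: tmon_mult) (intro m.span_scale m.span_base imageI)
  }
qed

lemma lead_expo_eqI:
  assumes "monomial_order prec" "l \<in> Poly_Mapping.keys f"
    and "\<And>b. b \<in> Poly_Mapping.keys f \<Longrightarrow> b \<noteq> l \<Longrightarrow> prec b l"
  shows "lead_expo prec f = l"
  unfolding lead_expo_def
proof (rule the_equality)
  fix a
  assume "a \<in> Poly_Mapping.keys f \<and> (\<forall>b\<in>Poly_Mapping.keys f. b \<noteq> a \<longrightarrow> prec b a)"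
  then show "a = l"
    using assms unfolding monomial_order_def by (metis irreflpD transpD)
qed (use assms in auto)

text \<open>Finiteness of the support replaces well-foundedness of the order here.\<close>

lemma lead_expo_greatest:
  assumes "monomial_order prec" "f \<noteq> 0"
  shows "lead_expo prec f \<in> Poly_Mapping.keys f"
    and "\<And>b. b \<in> Poly_Mapping.keys f \<Longrightarrow> b \<noteq> lead_expo prec f \<Longrightarrow> prec b (lead_expo prec f)"
proof -
  have "transp_on (Poly_Mapping.keys f) prec" "totalp_on (Poly_Mapping.keys f) prec"
    using assms(1) unfolding monomial_order_def
    by (meson subset_UNIV transp_on_subset totalp_on_subset)+
  moreover have "asymp_on (Poly_Mapping.keys f) prec"
    using assms(1) unfolding monomial_order_def
    by (metis asymp_onI irreflpD transpD)
  ultimately obtain l where l: "l \<in> Poly_Mapping.keys f"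
    "\<forall>b\<in>Poly_Mapping.keys f. b \<noteq> l \<longrightarrow> prec b l"
    using Finite_Set.bex_greatest_element[of "Poly_Mapping.keys f" prec] assms(2) by auto
  then have "lead_expo prec f = l"
    using assms(1) by (intro lead_expo_eqI) auto
  with l show "lead_expo prec f \<in> Poly_Mapping.keys f"
    "\<And>b. b \<in> Poly_Mapping.keys f \<Longrightarrow> b \<noteq> lead_expo prec f \<Longrightarrow> prec b (lead_expo prec f)"
    by auto
qed

section \<open>Grids whose power sums single out the top exponent\<close>

text \<open>The conditions on the power sums drive the duality, and \<open>x\<^bsup>D\<^sub>i + 1\<^esup> = x\<close> supplies explicit
  vanishing polynomials with leading monomials \<open>t\<^sub>i\<^bsup>D\<^sub>i + 1\<^esup>\<close>; positivity of \<open>D\<^sub>i\<close> makes these the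
  leading ones. Power sums of exponent above \<open>D\<^sub>i\<close> are left unconstrained: over \<open>A\<^sub>i \<union> {0}\<close> they
  can be nonzero, for example at \<open>2 d\<^sub>i\<close>.\<close>

locale power_sum_grid =
  fixes B :: "'n::finite \<Rightarrow> 'k::field set" and D :: "'n expo"
  assumes finite_B: "finite (B i)"
    and D_pos: "expo_at D i > 0"
    and power_Suc_D: "x \<in> B i \<Longrightarrow> x ^ Suc (expo_at D i) = x"
    and power_sum_low: "n < expo_at D i \<Longrightarrow> (\<Sum>x\<in>B i. x ^ n) = 0"
    and power_sum_top: "(\<Sum>x\<in>B i. x ^ expo_at D i) \<noteq> 0"
begin

definition grid :: "('n \<Rightarrow> 'k) set" where
  "grid = {P. \<forall>i. P i \<in> B i}"

definition box :: "'n expo set" where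
  "box = {c. \<forall>i. expo_at c i \<le> expo_at D i}"

lemma eval_sum_grid_tmon:
  "eval_sum grid (tmon c) = (\<Prod>i\<in>UNIV. \<Sum>x\<in>B i. x ^ expo_at c i)"
proof -
  have "grid = PiE UNIV B"
    by (auto simp: grid_def PiE_def)
  then show ?thesis
    using prod_sum_PiE[of UNIV B "\<lambda>i x. x ^ expo_at c i"] finite_B
    by (simp add: eval_sum_def peval_single tmon_def)
qed

lemma eval_sum_grid_tmon_D: "eval_sum grid (tmon D) \<noteq> 0"
  using power_sum_top by (simp add: eval_sum_grid_tmon prod_zero_iff)

lemma eval_sum_grid_tmon_eq_0:
  assumes "expo_at c i < expo_at D i"
  shows "eval_sum grid (tmon c) = 0"
  using power_sum_low[OF assms] by (auto simp: eval_sum_grid_tmon prod_zero_iff)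

text \<open>A monomial of total degree below that of \<open>D\<close> must fall short of \<open>D\<close> in some variable.\<close>

lemma eval_sum_grid_low_degree:
  assumes "\<And>c. c \<in> Poly_Mapping.keys f \<Longrightarrow> tdeg c < tdeg D"
  shows "eval_sum grid f = 0"
proof -
  have "eval_sum grid (tmon c) = 0" if c: "c \<in> Poly_Mapping.keys f" for c
  proof -
    have "\<exists>i. expo_at c i < expo_at D i"
    proof (rule ccontr)
      assume "\<nexists>i. expo_at c i < expo_at D i"
      then have "tdeg D \<le> tdeg c"
        unfolding tdeg_def by (intro sum_mono) (simp add: not_less)
      then show False using assms[OF c] by simp
    qed
    then show ?thesis using eval_sum_grid_tmon_eq_0 by blast
  qed
  then show ?thesis
    using eval_sum_mult_tmon[of grid f 0] by (simp add: tmon_def)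
qed

text \<open>Multiplying by the complementary monomial \<open>t\<^bsup>D - l\<^esup>\<close> isolates the coefficient of \<open>t\<^sup>l\<close>:
  a term \<open>t\<^sup>b\<close> of \<open>f\<close> survives the evaluation sum only if \<open>b + (D - l) \<ge> D\<close> in
  every variable, that is \<open>b \<ge> l\<close>, and since no term has degree above that of \<open>l\<close> this forces
  \<open>b = l\<close>. The other exponents of \<open>f\<close> may lie outside the box, so the lemma speaks about arbitrary
  elements of the vanishing ideal as well as about spans of standard monomials.\<close>

lemma eval_sum_complement_top_term:
  assumes "l \<in> Poly_Mapping.keys f" "l \<in> box"
    and "\<And>b. b \<in> Poly_Mapping.keys f \<Longrightarrow> tdeg b \<le> tdeg l"
  shows "eval_sum grid (f * tmon (D - l)) \<noteq> 0"
proof -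
  have l: "expo_at l i \<le> expo_at D i" for i
    using assms(2) by (simp add: box_def)
  have other: "eval_sum grid (tmon (b + (D - l))) = 0"
    if b: "b \<in> Poly_Mapping.keys f" and "b \<noteq> l" for b
  proof -
    have "\<exists>i. expo_at b i < expo_at l i"
    proof (rule ccontr)
      assume "\<nexists>i. expo_at b i < expo_at l i"
      then have ge: "expo_at l i \<le> expo_at b i" for i by (simp add: not_less)
      have "b - l + l = b"
        by (rule complement_add) (rule ge)
      moreover have "tdeg (b - l) = 0"
        using tdeg_complement[of l b] ge assms(3)[OF b] by simp
      then have "b - l = 0"
        by (intro poly_mapping_eqI) (simp add: tdeg_def)
      ultimately show False using \<open>b \<noteq> l\<close> by simp
    qed
    then obtain i where "expo_at b i < expo_at l i" ..
    then show ?thesis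
      using l[of i] by (intro eval_sum_grid_tmon_eq_0[of _ i]) (simp add: lookup_add lookup_minus)
  qed
  have "eval_sum grid (f * tmon (D - l)) = Poly_Mapping.lookup f l * eval_sum grid (tmon (l + (D - l)))"
    unfolding eval_sum_mult_tmon using assms(1) other
    by (subst sum.remove[of _ l]) (auto intro!: sum.neutral)
  also have "l + (D - l) = D"
    using complement_add[OF l] by (simp add: add.commute)
  finally show ?thesis
    using eval_sum_grid_tmon_D assms(1) by (simp add: in_keys_iff)
qed

lemma power_Suc_D_minus_var_vanishes:
  "tmon (Poly_Mapping.single i (Suc (expo_at D i))) - tvar i \<in> vanishing_ideal grid"
proof -
  have "peval (tmon (Poly_Mapping.single i n)) P = P i ^ n" for n and P :: "'n \<Rightarrow> 'k"
    unfolding tmon_def peval_single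
    by (subst prod.remove[of _ i]) (auto simp: lookup_single when_def intro!: prod.neutral)
  moreover have "peval (f - g) P = peval f P - peval g P" for f g and P :: "'n \<Rightarrow> 'k"
    using peval_add[of "f - g" g P] by simp
  ultimately show ?thesis
    using power_Suc_D by (auto simp: vanishing_ideal_def grid_def tvar_def simp del: power_Suc)
qed

text \<open>The polynomials \<open>t\<^sub>i\<^bsup>D\<^sub>i + 1\<^esup> - t\<^sub>i\<close> put every monomial outside the box into the initial ideal.
  Conversely no leading monomial of the vanishing ideal lies in the box: because the order is
  graded it would be a term of top degree, and the complementary monomial would give a nonzero
  evaluation sum of a polynomial that vanishes on the grid.\<close>

lemma standard_monomials_grid:
  fixes prec :: "'n expo \<Rightarrow> 'n expo \<Rightarrow> bool"
  assumes "graded_monomial_order prec"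
  shows "standard_monomials prec (vanishing_ideal grid) = tmon ` box"
proof -
  let ?I = "vanishing_ideal grid"
  define M where "M = lead_expo prec ` (?I - {0})"
  have mo: "monomial_order prec"
    and graded: "tdeg a < tdeg b \<Longrightarrow> prec a b" for a b
    using assms by (auto simp: graded_monomial_order_def)
  have "{tmon (lead_expo prec f) | f. f \<in> ?I \<and> f \<noteq> 0} = (tmon ` M :: ('n, 'k) mpol set)"
    by (auto simp: M_def)
  then have initial: "tmon a \<in> initial_ideal prec ?I \<longleftrightarrow> (\<exists>l\<in>M. \<exists>c. a = c + l)" for a
    by (simp add: initial_ideal_def tmon_in_monomial_ideal_iff)
  have outside: "\<exists>l\<in>M. \<exists>c. a = c + l" if a: "a \<notin> box" for a
  proof -
    obtain i where i: "Suc (expo_at D i) \<le> expo_at a i"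
      using a by (auto simp: box_def not_le Suc_le_eq)
    let ?m = "Poly_Mapping.single i (Suc (expo_at D i))"
    \<comment> \<open>Exponents \<open>D\<^sub>i + 1\<close> and \<open>1\<close> differ since \<open>D\<^sub>i > 0\<close>, so nothing cancels.\<close>
    let ?f = "tmon ?m - tvar i :: ('n, 'k) mpol"
    have deg: "tdeg (Poly_Mapping.single i n) = n" for n
      by (simp add: tdeg_def lookup_single when_def)
    have neq: "?m \<noteq> Poly_Mapping.single i 1"
      using D_pos[of i] deg by (metis One_nat_def Suc_inject less_irrefl)
    have lk: "Poly_Mapping.lookup ?f b = (if b = ?m then 1 else if b = Poly_Mapping.single i 1 then - 1 else 0)" for b
      using neq by (auto simp: lookup_minus tmon_def tvar_def lookup_single when_def)
    have "lead_expo prec ?f = ?m"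
    proof (rule lead_expo_eqI[OF mo])
      show "?m \<in> Poly_Mapping.keys ?f" by (simp add: in_keys_iff lk)
    next
      fix b assume "b \<in> Poly_Mapping.keys ?f" "b \<noteq> ?m"
      then have "b = Poly_Mapping.single i 1"
        by (simp add: in_keys_iff lk split: if_splits)
      then show "prec b ?m" using D_pos[of i] by (intro graded) (simp add: deg)
    qed
    moreover have "?f \<noteq> 0" using lk[of ?m] by auto
    ultimately have "?m \<in> M"
      using power_Suc_D_minus_var_vanishes[of i] unfolding M_def by force
    moreover have "a = (a - ?m) + ?m"
      using i by (intro complement_add[symmetric]) (auto simp: lookup_single when_def)
    ultimately show ?thesis by blast
  qed
  have inside: False if "c + l \<in> box" "l \<in> M" for c l
  proof -
    obtain f where f: "f \<in> ?I" "f \<noteq> 0" "l = lead_expo prec f"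
      using \<open>l \<in> M\<close> by (auto simp: M_def)
    have "l \<in> box"
      using \<open>c + l \<in> box\<close> by (auto simp: box_def lookup_add intro: add_leD2)
    moreover have "tdeg b \<le> tdeg l" if "b \<in> Poly_Mapping.keys f" for b
      using lead_expo_greatest(2)[OF mo f(2) that] graded[of l b] mo f(3)
      unfolding monomial_order_def by (metis irreflpD not_less order_refl transpD)
    ultimately have "eval_sum grid (f * tmon (D - l)) \<noteq> 0"
      using lead_expo_greatest(1)[OF mo f(2)] f(3) by (intro eval_sum_complement_top_term) auto
    then show False using eval_sum_vanishing[OF f(1)] by simp
  qed
  have "tmon a \<notin> initial_ideal prec ?I \<longleftrightarrow> a \<in> box" for a
    unfolding initial using outside[of a] inside by metis
  then show ?thesis
    by (auto simp: standard_monomials_def)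
qed

text \<open>For the inclusion from left to right, test \<open>g\<close> against the complement of one of its terms of
  maximal degree: the nonzero evaluation sum shows that this complement has degree above \<open>d\<close>. For
  the converse, all terms of \<open>g f\<close> have degree below that of \<open>D\<close>.\<close>

lemma algebraic_dual_grid:
  assumes "graded_monomial_order prec"
  shows "algebraic_dual prec grid (Kspan (tmon ` {a \<in> box. int (tdeg a) \<le> d})) =
    Kspan (tmon ` {b \<in> box. int (tdeg b) \<le> int (tdeg D) - d - 1})"
proof (intro equalityI subsetI)
  fix g
  assume "g \<in> algebraic_dual prec grid (Kspan (tmon ` {a \<in> box. int (tdeg a) \<le> d}))"
  then have g: "Poly_Mapping.keys g \<subseteq> box"
    and orth: "\<And>a. a \<in> box \<Longrightarrow> int (tdeg a) \<le> d \<Longrightarrow> eval_sum grid (g * tmon a) = 0"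
    by (auto simp: algebraic_dual_def standard_monomials_grid[OF assms] Kspan_tmon keys_tmon)
  have "int (tdeg b) \<le> int (tdeg D) - d - 1" if b: "b \<in> Poly_Mapping.keys g" for b
  proof -
    have "Max (tdeg ` Poly_Mapping.keys g) \<in> tdeg ` Poly_Mapping.keys g"
      using b by (intro Max_in) auto
    then obtain l where l: "l \<in> Poly_Mapping.keys g" "tdeg l = Max (tdeg ` Poly_Mapping.keys g)"
      by auto
    have max: "tdeg c \<le> tdeg l" if "c \<in> Poly_Mapping.keys g" for c
      using that by (simp add: l(2))
    have "l \<in> box" using g l(1) by auto
    then have "eval_sum grid (g * tmon (D - l)) \<noteq> 0"
      using l(1) max by (intro eval_sum_complement_top_term)
    moreover have "D - l \<in> box"
      by (simp add: box_def lookup_minus)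
    ultimately have "\<not> int (tdeg (D - l)) \<le> d"
      using orth by blast
    moreover have "tdeg (D - l) + tdeg l = tdeg D"
      using \<open>l \<in> box\<close> by (intro tdeg_complement) (simp add: box_def)
    ultimately show ?thesis
      using max[OF b] by linarith
  qed
  then show "g \<in> Kspan (tmon ` {b \<in> box. int (tdeg b) \<le> int (tdeg D) - d - 1})"
    using g by (auto simp: Kspan_tmon)
next
  fix g :: "('n, 'k) mpol"
  assume "g \<in> Kspan (tmon ` {b \<in> box. int (tdeg b) \<le> int (tdeg D) - d - 1})"
  then have g: "Poly_Mapping.keys g \<subseteq> {b \<in> box. int (tdeg b) \<le> int (tdeg D) - d - 1}"
    by (simp add: Kspan_tmon)
  have "eval_sum grid (g * f) = 0" if f: "Poly_Mapping.keys f \<subseteq> {a \<in> box. int (tdeg a) \<le> d}" for f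
  proof (rule eval_sum_grid_low_degree)
    fix c assume "c \<in> Poly_Mapping.keys (g * f)"
    then obtain b a where "c = b + a" "b \<in> Poly_Mapping.keys g" "a \<in> Poly_Mapping.keys f"
      using keys_mult[of g f] by blast
    then show "tdeg c < tdeg D"
      using f g by (force simp: tdeg_add)
  qed
  then show "g \<in> algebraic_dual prec grid (Kspan (tmon ` {a \<in> box. int (tdeg a) \<le> d}))"
    using g by (auto simp: algebraic_dual_def standard_monomials_grid[OF assms] Kspan_tmon)
qed

text \<open>The map \<open>a \<mapsto> D - a\<close> is an involution of the box that sends degree \<open>m\<close> to \<open>tdeg D - m\<close>.\<close>

lemma box_minus_complements:
  "box - (\<lambda>a. D - a) ` {a \<in> box. int (tdeg a) \<le> d} =
    {b \<in> box. int (tdeg b) \<le> int (tdeg D) - d - 1}"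
proof -
  have *: "b \<in> (\<lambda>a. D - a) ` {a \<in> box. int (tdeg a) \<le> d} \<longleftrightarrow> int (tdeg D) - d \<le> int (tdeg b)"
    if "b \<in> box" for b
  proof
    assume "b \<in> (\<lambda>a. D - a) ` {a \<in> box. int (tdeg a) \<le> d}"
    then obtain a where a: "a \<in> box" "int (tdeg a) \<le> d" "b = D - a" by auto
    then have "tdeg b + tdeg a = tdeg D"
      by (simp add: tdeg_complement box_def)
    then show "int (tdeg D) - d \<le> int (tdeg b)" using a by linarith
  next
    assume deg: "int (tdeg D) - d \<le> int (tdeg b)"
    have "tdeg (D - b) + tdeg b = tdeg D"
      using that by (intro tdeg_complement) (simp add: box_def)
    then have "int (tdeg (D - b)) \<le> d" using deg by linarith
    moreover have "D - b \<in> box" by (simp add: box_def lookup_minus)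
    moreover have "b = D - (D - b)"
      using that by (intro poly_mapping_eqI) (simp add: box_def lookup_minus)
    ultimately show "b \<in> (\<lambda>a. D - a) ` {a \<in> box. int (tdeg a) \<le> d}" by blast
  qed
  show ?thesis
  proof (rule Set.set_eqI)
    fix b :: "'n expo"
    have "int (tdeg D) - d \<le> int (tdeg b) \<longleftrightarrow> \<not> int (tdeg b) \<le> int (tdeg D) - d - 1"
      by linarith
    then show "b \<in> box - (\<lambda>a. D - a) ` {a \<in> box. int (tdeg a) \<le> d} \<longleftrightarrow>
        b \<in> {b \<in> box. int (tdeg b) \<le> int (tdeg D) - d - 1}"
      using *[of b] by (cases "b \<in> box") (simp_all only: Diff_iff mem_Collect_eq simp_thms)
  qed
qed

end

section \<open>The duality theorem\<close>

lemma power_sum_grid_subgroup: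
  fixes A :: "'n::finite \<Rightarrow> 'k::{field, finite} set" and D :: "'n expo"
  assumes sub: "\<And>i. subgroup (A i) units_group"
    and D: "\<And>i. expo_at D i = card (A i)"
    and card: "\<And>i. CHAR('k) dvd card (insert 0 (A i))"
  shows "power_sum_grid (\<lambda>i. insert 0 (A i)) D"
proof
  fix i
  have nz: "0 \<notin> A i"
    using subgroup.subset[OF sub[of i]] by (auto simp: units_group_def)
  have closed: "x * y \<in> A i" if "x \<in> A i" "y \<in> A i" for x y
    using subgroup.m_closed[OF sub[of i] that] by (simp add: units_group_def)
  have ne: "A i \<noteq> {}"
    using subgroup.one_closed[OF sub[of i]] by auto
  have char0: "of_nat (card (insert 0 (A i))) = (0 :: 'k)"
    using card by (simp add: of_nat_eq_0_iff_char_dvd)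
  note power_sum = power_sum_insert_0[OF finite nz closed char0 _ ne]
  show "finite (insert 0 (A i))" by simp
  show "expo_at D i > 0" using ne by (simp add: D card_gt_0_iff)
  show "x ^ Suc (expo_at D i) = x" if "x \<in> insert 0 (A i)" for x
    using that power_eq_one_of_finite_mult_closed[OF finite nz closed] by (auto simp: D)
  show "(\<Sum>x\<in>insert 0 (A i). x ^ n) = 0" if "n < expo_at D i" for n
    using power_sum[of n] that by (simp add: D)
  show "(\<Sum>x\<in>insert 0 (A i). x ^ expo_at D i) \<noteq> 0"
    using power_sum[of "card (A i)"] by (simp add: D)
qed

theorem theorem7p11:
  fixes p :: nat
    and A B :: "'n::finite \<Rightarrow> 'k::{field, finite} set"
    and X :: "('n \<Rightarrow> 'k) set"
    and I \<Delta> L :: "('n, 'k) mpol set"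
    and prec :: "'n expo \<Rightarrow> 'n expo \<Rightarrow> bool"
    and dd e :: "'n \<Rightarrow> nat"
    and d r0 :: int
    and k :: nat
    and a :: "nat \<Rightarrow> 'n expo"
    and tb :: "nat \<Rightarrow> ('n, 'k) mpol"
  assumes "p = CHAR('k)"
    and "\<And>i. subgroup (A i) units_group"
    and "\<And>i. B i = A i \<union> {0}"
    and "X = {P. \<forall>i. P i \<in> B i}"
    and "I = vanishing_ideal X"
    and "graded_monomial_order prec"
    and "\<Delta> = standard_monomials prec I"
    and "\<And>i. dd i = card (A i)"
    and "\<And>i. e i = card (B i)"
    and "\<And>i. gcd (e i) p = p"
    and "r0 = (\<Sum>i\<in>UNIV. int (e i) - 1)"
    and "-1 \<le> d" and "d \<le> r0"
    and "polys_le d \<inter> \<Delta> = {tmon (a i) | i. i \<in> {1..k}}"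
    and "L = Kspan (polys_le d \<inter> \<Delta>)"
    and "\<And>i. tb i = (\<Prod>j\<in>UNIV. tvar j ^ (dd j - expo_at (a i) j))"
  shows "algebraic_dual prec X L = Kspan (\<Delta> - {tb i | i. i \<in> {1..k}}) \<and>
         Kspan (\<Delta> - {tb i | i. i \<in> {1..k}}) = Kspan (polys_le (r0 - d - 1) \<inter> \<Delta>)"
proof -
  define D :: "'n expo" where "D = Abs_poly_mapping dd"
  have D: "expo_at D i = dd i" for i
    by (simp add: D_def)
  have B: "B i = insert 0 (A i)" for i
    using assms(3) by auto
  have "CHAR('k) dvd card (insert 0 (A i))" for i
    using assms(1,9) assms(10)[of i] B by (metis gcd_dvd1)
  then interpret power_sum_grid "\<lambda>i. insert 0 (A i)" D
    using assms(2,8) D by (intro power_sum_grid_subgroup) auto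
  have X: "X = grid"
    by (simp add: assms(4) grid_def B)
  have \<Delta>: "\<Delta> = tmon ` box"
    using standard_monomials_grid[OF assms(6)] by (simp add: assms(5,7) X)
  have "0 \<notin> A i" for i
    using subgroup.subset[OF assms(2)[of i]] by (auto simp: units_group_def)
  then have "int (e i) - 1 = int (dd i)" for i
    by (simp add: assms(8,9) B)
  then have r0: "r0 = int (tdeg D)"
    by (simp add: assms(11) tdeg_def D)
  have low: "polys_le n \<inter> \<Delta> = tmon ` {c \<in> box. int (tdeg c) \<le> n}" for n
    by (auto simp: \<Delta> polys_le_def keys_tmon)
  have "(tmon ` (a ` {1..k}) :: ('n, 'k) mpol set) = tmon ` {c \<in> box. int (tdeg c) \<le> d}"
    using assms(14) by (auto simp: low)
  then have a: "a ` {1..k} = {c \<in> box. int (tdeg c) \<le> d}"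
    by (subst (asm) inj_image_eq_iff) (auto simp: inj_def tmon_inject)
  have "tb i = tmon (D - a i)" for i
    using prod_tvar_power[of "D - a i"] by (simp add: assms(16) lookup_minus D)
  then have "{tb i | i. i \<in> {1..k}} = tmon ` (\<lambda>c. D - c) ` a ` {1..k}"
    by auto
  then have "\<Delta> - {tb i | i. i \<in> {1..k}} =
      tmon ` box - tmon ` (\<lambda>c. D - c) ` {c \<in> box. int (tdeg c) \<le> d}"
    by (simp only: \<Delta> a)
  also have "\<dots> = tmon ` (box - (\<lambda>c. D - c) ` {c \<in> box. int (tdeg c) \<le> d})"
    by (rule image_set_diff[symmetric]) (simp add: inj_def tmon_inject)
  also have "\<dots> = polys_le (r0 - d - 1) \<inter> \<Delta>"
    by (simp only: box_minus_complements low r0)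
  finally show ?thesis
    using algebraic_dual_grid[OF assms(6), of d] by (simp add: assms(15) X low r0)
qed

end
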